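(* Let $A$ and $B$ be finite sets of UTVPI constraints over the rationals such that $A\wedge B$ is unsatisfiable over $\mathbb Q$, and let $A'$ and $B'$ be their difference-logic encodings. Let $I'$ be the difference-logic interpolant built from a negative-weight cycle $C$ of the constraint graph $G(A'\wedge B')$, namely $I'=\bot$ if all edges of $C$ come from $A'$, $I'=\top$ if all come from $B'$, and otherwise $I'$ is the conjunction of the summary constraints of the maximal $A'$-paths of $C$. Then $I=\Upsilon(I')$ is an interpolant for $(A,B)$.
   Context: A UTVPI constraint is an atom $(0\le a x_1 + b x_2 + k)$ with $a,b\in\{-1,0,1\}$ and $k$ a numerical constant. For each UTVPI variable $x$ introduce two difference-logic variables $x^+$ and $x^-$, and let $\Upsilon(x^+)=x$, $\Upsilon(x^-)=-x$; for a signed variable $s=\pm x$ write $v(x)=x^+$, $v(-x)=x^-$. Encoding: a constraint $(0\le s_1+s_2+k)$ with $s_1,s_2$ signed occurrences of distinct variables is encoded as the two difference-logic constraints $(0\le v(s_1)-v(-s_2)+k)$ and $(0\le v(s_2)-v(-s_1)+k)$; a constraint $(0\le s+k)$ with one signed variable is encoded as $(0\le v(s)-v(-s)+2k)$. $\Upsilon$ extends to difference-logic constraints by $\Upsilon(0\le v-u+k) = (0\le \Upsilon(v)-\Upsilon(u)+k)$ and to conjunctions componentwise. The constraint graph has an edge $u\xrightarrow{c} v$ for each constraint $(0\le v-u+c)$, labelled as coming from $A'$ or from $B'$. A maximal $A'$-path of $C$ is a maximal path $u_1\xrightarrow{c_1}\cdots\xrightarrow{c_{n-1}}u_n$ of consecutive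 $A'$-edges of $C$ preceded and followed in $C$ by $B'$-edges; its summary constraint is $(0\le u_n-u_1+\sum_i c_i)$. An interpolant for $(A,B)$ is a formula $I$ with $A\models I$, $I\wedge B$ unsatisfiable, and every variable of $I$ occurring both in $A$ and in $B$ (over $\mathbb Q$). *)

theory Defs
  imports Main "HOL.Rat" "Graph_Theory.Arc_Walk"
begin

section \<open>Linear atoms and UTVPI constraints\<close>

datatype 'x signed = Pos 'x | Neg 'x

fun var :: "'x signed \<Rightarrow> 'x" where
  "var (Pos x) = x"
| "var (Neg x) = x"

fun opp :: "'x signed \<Rightarrow> 'x signed" where
  "opp (Pos x) = Neg x"
| "opp (Neg x) = Pos x"

fun signed_val :: "('x \<Rightarrow> rat) \<Rightarrow> 'x signed \<Rightarrow> rat" where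
  "signed_val \<sigma> (Pos x) = \<sigma> x"
| "signed_val \<sigma> (Neg x) = - \<sigma> x"

text \<open>\<open>Geq0 [s\<^sub>1, \<dots>, s\<^sub>n] k\<close> is the atom \<open>0 \<le> s\<^sub>1 + \<dots> + s\<^sub>n + k\<close>. The atoms of an interpolant
  may repeat a variable, e.g. \<open>0 \<le> x + x + k\<close>.\<close>

datatype 'x lin_atom = Geq0 "'x signed list" rat

fun lin_holds :: "('x \<Rightarrow> rat) \<Rightarrow> 'x lin_atom \<Rightarrow> bool" where
  "lin_holds \<sigma> (Geq0 ss k) \<longleftrightarrow> 0 \<le> sum_list (map (signed_val \<sigma>) ss) + k"

fun lin_vars :: "'x lin_atom \<Rightarrow> 'x set" where
  "lin_vars (Geq0 ss k) = var ` set ss"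

text \<open>\<open>0 \<le> a x\<^sub>1 + b x\<^sub>2 + k\<close> with \<open>a, b \<in> {-1, 0, 1}\<close> is represented by its signed occurrences:
  a summand with coefficient \<open>0\<close> is absent.\<close>

fun is_utvpi :: "'x lin_atom \<Rightarrow> bool" where
  "is_utvpi (Geq0 ss k) \<longleftrightarrow> length ss \<le> 2 \<and> distinct (map var ss)"


section \<open>Difference logic and the encoding\<close>

datatype 'x dvar = Plus 'x | Minus 'x

text \<open>\<open>Diff v u k\<close> is the constraint \<open>0 \<le> v - u + k\<close>.\<close>

datatype 'v dl_constr = Diff (plus_var: 'v) (minus_var: 'v) (const: rat)

fun dvar_of :: "'x signed \<Rightarrow> 'x dvar" where
  "dvar_of (Pos x) = Plus x"
| "dvar_of (Neg x) = Minus x"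

text \<open>A variable-free atom \<open>0 \<le> k\<close> mentions no difference variable and contributes no
  difference constraint. The last equation is never used on UTVPI constraints.\<close>

fun encode :: "'x lin_atom \<Rightarrow> 'x dvar dl_constr set" where
  "encode (Geq0 [s1, s2] k) =
     {Diff (dvar_of s1) (dvar_of (opp s2)) k, Diff (dvar_of s2) (dvar_of (opp s1)) k}"
| "encode (Geq0 [s] k) = {Diff (dvar_of s) (dvar_of (opp s)) (2 * k)}"
| "encode (Geq0 [] k) = {}"
| "encode (Geq0 (s1 # s2 # s3 # ss) k) = {}"

definition encode_set :: "'x lin_atom set \<Rightarrow> 'x dvar dl_constr set" where
  "encode_set A = (\<Union>c\<in>A. encode c)"

fun Ups_var :: "'x dvar \<Rightarrow> 'x signed" where
  "Ups_var (Plus x) = Pos x"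
| "Ups_var (Minus x) = Neg x"

fun Ups_constr :: "'x dvar dl_constr \<Rightarrow> 'x lin_atom" where
  "Ups_constr (Diff v u k) = Geq0 [Ups_var v, opp (Ups_var u)] k"


section \<open>Formulas and interpolants\<close>

datatype (atoms: 'a) formula =
    Bot
  | Top
  | Atom 'a
  | Not "'a formula"
  | And "'a formula" "'a formula"
  | Or "'a formula" "'a formula"

primrec eval_formula :: "('a \<Rightarrow> bool) \<Rightarrow> 'a formula \<Rightarrow> bool" where
  "eval_formula h Bot \<longleftrightarrow> False"
| "eval_formula h Top \<longleftrightarrow> True"
| "eval_formula h (Atom a) \<longleftrightarrow> h a"
| "eval_formula h (Not F) \<longleftrightarrow> \<not> eval_formula h F"
| "eval_formula h (And F G) \<longleftrightarrow> eval_formula h F \<and> eval_formula h G"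
| "eval_formula h (Or F G) \<longleftrightarrow> eval_formula h F \<or> eval_formula h G"

fun conj_list :: "'a formula list \<Rightarrow> 'a formula" where
  "conj_list [] = Top"
| "conj_list [F] = F"
| "conj_list (F # G # Fs) = And F (conj_list (G # Fs))"

definition Ups :: "'x dvar dl_constr formula \<Rightarrow> 'x lin_atom formula" where
  "Ups = map_formula Ups_constr"

text \<open>A set of atoms stands for its conjunction.\<close>

definition sat_set :: "('x \<Rightarrow> rat) \<Rightarrow> 'x lin_atom set \<Rightarrow> bool" where
  "sat_set \<sigma> A \<longleftrightarrow> (\<forall>c\<in>A. lin_holds \<sigma> c)"

definition vars_set :: "'x lin_atom set \<Rightarrow> 'x set" where
  "vars_set A = (\<Union>c\<in>A. lin_vars c)"

definition interpolant :: "'x lin_atom set \<Rightarrow> 'x lin_atom set \<Rightarrow> 'x lin_atom formula \<Rightarrow> bool" where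
  "interpolant A B I \<longleftrightarrow>
     (\<forall>\<sigma>. sat_set \<sigma> A \<longrightarrow> eval_formula (lin_holds \<sigma>) I) \<and>
     \<not> (\<exists>\<sigma>. eval_formula (lin_holds \<sigma>) I \<and> sat_set \<sigma> B) \<and>
     vars_set (atoms I) \<subseteq> vars_set A \<inter> vars_set B"


section \<open>Constraint graph\<close>

text \<open>A constraint belonging to both \<open>A'\<close> and \<open>B'\<close> yields two parallel edges with different
  labels.\<close>

datatype origin = FromA | FromB

datatype 'v edge = Edge (origin: origin) (constr: "'v dl_constr")

definition src :: "'v edge \<Rightarrow> 'v" where
  "src e = minus_var (constr e)"

definition tgt :: "'v edge \<Rightarrow> 'v" where
  "tgt e = plus_var (constr e)"

definition weight :: "'v edge list \<Rightarrow> rat" where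
  "weight p = sum_list (map (\<lambda>e. const (constr e)) p)"

definition constraint_graph ::
    "'v dl_constr set \<Rightarrow> 'v dl_constr set \<Rightarrow> ('v, 'v edge) pre_digraph" where
  "constraint_graph A' B' =
     \<lparr> verts = plus_var ` (A' \<union> B') \<union> minus_var ` (A' \<union> B'),
       arcs = Edge FromA ` A' \<union> Edge FromB ` B',
       tail = src, head = tgt \<rparr>"

lemma wf_constraint_graph: "wf_digraph (constraint_graph A' B')"
  by unfold_locales (auto simp: constraint_graph_def src_def tgt_def)

text \<open>A cycle is a nonempty closed walk; vertices may repeat, so simple cycles are a special
  case.\<close>

definition negative_cycle :: "('v, 'v edge) pre_digraph \<Rightarrow> 'v edge list \<Rightarrow> bool" where
  "negative_cycle G C \<longleftrightarrow> wf_digraph.closed_w G C \<and> weight C < 0"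

abbreviation from_A :: "'v edge \<Rightarrow> bool" where
  "from_A e \<equiv> origin e = FromA"

abbreviation from_B :: "'v edge \<Rightarrow> bool" where
  "from_B e \<equiv> origin e = FromB"

text \<open>A cycle has no distinguished first edge, so a maximal \<open>A'\<close>-path may wrap around the end of
  the list. Each one is found as the initial \<open>A'\<close>-segment of the rotation that starts with it;
  \<open>set_max_A_paths\<close> below is the declarative description.\<close>

definition max_A_paths :: "'v edge list \<Rightarrow> 'v edge list list" where
  "max_A_paths C =
     map (takeWhile from_A)
       (filter (\<lambda>p. from_A (hd p) \<and> from_B (last p)) (map (\<lambda>n. rotate n C) [0..<length C]))"

lemma set_max_A_paths:
  "set (max_A_paths C) =
     {q. q \<noteq> [] \<and> (\<forall>e\<in>set q. from_A e) \<and>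
         (\<exists>n r. rotate n C = q @ r \<and> r \<noteq> [] \<and> from_B (hd r) \<and> from_B (last r))}"
  (is "?L = ?R")
proof (intro equalityI subsetI)
  fix q assume "q \<in> ?L"
  then obtain n where n: "n < length C" "from_A (hd (rotate n C))" "from_B (last (rotate n C))"
      and q: "q = takeWhile from_A (rotate n C)"
    by (auto simp: max_A_paths_def)
  define r where "r = dropWhile from_A (rotate n C)"
  have ne: "rotate n C \<noteq> []" using n by auto
  have split: "rotate n C = q @ r" by (simp add: q r_def)
  have "q \<noteq> []" using ne n(2) by (cases "rotate n C") (auto simp: q)
  moreover have all: "\<forall>e\<in>set q. from_A e" by (auto simp: q dest: set_takeWhileD)
  moreover have "r \<noteq> []"
  proof
    assume "r = []"
    then have "last (rotate n C) \<in> set q" using split ne by (metis append_Nil2 last_in_set)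
    then show False using all n(3) by auto
  qed
  moreover have "from_B (hd r)"
    using hd_dropWhile[of from_A "rotate n C"] \<open>r \<noteq> []\<close> origin.exhaust unfolding r_def by metis
  moreover have "from_B (last r)" using n(3) split \<open>r \<noteq> []\<close> by simp
  ultimately show "q \<in> ?R" using split by blast
next
  fix q assume "q \<in> ?R"
  then obtain n r where q: "q \<noteq> []" "\<forall>e\<in>set q. from_A e" and
      r: "rotate n C = q @ r" "r \<noteq> []" "from_B (hd r)" "from_B (last r)"
    by blast
  define m where "m = n mod length C"
  have "C \<noteq> []" using q(1) r(1) by auto
  then have m: "m < length C" "rotate m C = q @ r"
    using r(1) by (auto simp: m_def simp flip: rotate_conv_mod)
  have "from_A (hd (q @ r))" "from_B (last (q @ r))" using q r by auto
  moreover have "takeWhile from_A (q @ r) = q" using q r by (cases r) auto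
  ultimately show "q \<in> ?L" using m by (force simp: max_A_paths_def)
qed

definition summary :: "'v edge list \<Rightarrow> 'v dl_constr" where
  "summary p = Diff (tgt (last p)) (src (hd p)) (weight p)"

definition dl_interpolant :: "'v edge list \<Rightarrow> 'v dl_constr formula" where
  "dl_interpolant C =
     (if \<forall>e\<in>set C. from_A e then Bot
      else if \<forall>e\<in>set C. from_B e then Top
      else conj_list (map (\<lambda>p. Atom (summary p)) (max_A_paths C)))"

end

(* Every assignment to the UTVPI variables extends to the difference variables by x+ := x,
   x- := -x, and the encoding is sound for these extensions. So each summary constraint, read
   through Ups, follows from A by telescoping along its path. If the conjunction of the summaries
   and B held under some assignment, then cutting the cycle into its maximal A'-paths and single
   B'-edges would give a nonnegative total weight. The end points of a maximal A'-path lie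
   on A'-edges of the path and on the neighbouring B'-edges, so their variables are shared. *)

theory Submission
  imports Defs
begin

lemma signed_val_opp [simp]: "signed_val \<sigma> (opp s) = - signed_val \<sigma> s"
  by (cases s) auto

lemma var_opp [simp]: "var (opp s) = var s"
  by (cases s) auto

lemma Ups_var_dvar_of [simp]: "Ups_var (dvar_of s) = s"
  by (cases s) auto

text \<open>Reading \<open>Plus x\<close> as x and \<open>Minus x\<close> as -x turns both
  constraints of a two-variable atom back into that atom, since the two signs in front of
  \<open>s2\<close> (resp. \<open>s1\<close>) cancel. For a single signed variable it gives the atom
  doubled, hence the constant \<open>2 * k\<close>.\<close>

lemma encode_sound:
  assumes "d \<in> encode c" and "lin_holds \<sigma> c"
  shows "lin_holds \<sigma> (Ups_constr d)"
  using assms by (cases c rule: encode.cases) auto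

lemma encode_vars:
  assumes "d \<in> encode c"
  shows "lin_vars (Ups_constr d) \<subseteq> lin_vars c"
  using assms by (cases c rule: encode.cases) auto

lemma encode_set_sound:
  assumes "d \<in> encode_set A" and "sat_set \<sigma> A"
  shows "lin_holds \<sigma> (Ups_constr d)"
  using assms encode_sound by (auto simp: encode_set_def sat_set_def)

lemma encode_set_vars:
  assumes "d \<in> encode_set A"
  shows "lin_vars (Ups_constr d) \<subseteq> vars_set A"
  using assms encode_vars by (fastforce simp: encode_set_def vars_set_def)

lemma lin_vars_Ups_constr:
  "lin_vars (Ups_constr d) = {var (Ups_var (plus_var d)), var (Ups_var (minus_var d))}"
  by (cases d) auto

lemma eval_map_formula: "eval_formula h (map_formula f F) \<longleftrightarrow> eval_formula (\<lambda>a. h (f a)) F"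
  by (induction F) auto

lemma eval_conj_list: "eval_formula h (conj_list Fs) \<longleftrightarrow> (\<forall>F\<in>set Fs. eval_formula h F)"
  by (induction Fs rule: conj_list.induct) auto

lemma atoms_conj_list: "atoms (conj_list Fs) = (\<Union>F\<in>set Fs. atoms F)"
  by (induction Fs rule: conj_list.induct) auto

text \<open>Up to sign convention, this is the reduced cost of an edge from shortest-path theory,
  with the value of \<open>Ups_var v\<close> under \<sigma> as potential of the vertex v.\<close>

definition slack :: "('x \<Rightarrow> rat) \<Rightarrow> 'x dvar edge \<Rightarrow> rat" where
  "slack \<sigma> e = const (constr e) + signed_val \<sigma> (Ups_var (tgt e)) - signed_val \<sigma> (Ups_var (src e))"

lemma lin_holds_iff_slack: "lin_holds \<sigma> (Ups_constr (constr e)) \<longleftrightarrow> 0 \<le> slack \<sigma> e"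
  by (cases e; cases "constr e") (auto simp: slack_def src_def tgt_def)

text \<open>The potentials of inner vertices telescope. On a closed walk only the weight remains; on
  a maximal A'-path what remains is the value of its summary constraint.\<close>

lemma sum_slack_cas:
  assumes "pre_digraph.cas (constraint_graph A' B') u p v"
  shows "sum_list (map (slack \<sigma>) p)
    = weight p + signed_val \<sigma> (Ups_var v) - signed_val \<sigma> (Ups_var u)"
  using assms
  by (induction p arbitrary: u)
    (auto simp: pre_digraph.cas.simps constraint_graph_def weight_def slack_def)

lemma (in pre_digraph) cas_endpoints:
  assumes "cas u p v" and "p \<noteq> []"
  shows "u = tail G (hd p)" and "v = head G (last p)"
  using assms by (induction p arbitrary: u) auto

text \<open>The walk is restarted at the vertex between \<open>p\<close> and \<open>q\<close>. This
  makes every rotation of a cycle a cycle, as needed for A'-paths that wrap around the end of the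
  list.\<close>

lemma (in wf_digraph) closed_w_append_commute:
  assumes "closed_w (p @ q)"
  shows "closed_w (q @ p)"
proof -
  from assms obtain u where u: "awalk u (p @ q) u" and ne: "p @ q \<noteq> []"
    by (auto simp: closed_w_def)
  have "awalk u p (awlast u p)" "awalk (awlast u p) q u"
    using u by auto
  then have "awalk (awlast u p) (q @ p) (awlast u p)"
    by (rule awalk_appendI[rotated])
  then show ?thesis
    using ne by (auto simp: closed_w_def)
qed

lemma (in wf_digraph) closed_w_rotate:
  assumes "closed_w p"
  shows "closed_w (rotate n p)"
  using assms by (metis append_take_drop_id closed_w_append_commute rotate_drop_take)

text \<open>Induction on the length: split off the leading block of \<open>P\<close>-entries
  together with the entry after it. Only maximal blocks have to be bounded, and the condition on
  \<open>last L\<close> ensures that each of them is followed by an entry outside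
  \<open>P\<close>.\<close>

lemma sum_list_blocks_nonneg:
  fixes f :: "'a \<Rightarrow> 'b::ordered_comm_monoid_add"
  assumes "L \<noteq> [] \<Longrightarrow> \<not> P (last L)"
    and "\<And>e. e \<in> set L \<Longrightarrow> \<not> P e \<Longrightarrow> 0 \<le> f e"
    and "\<And>p q r. L = p @ q @ r \<Longrightarrow> q \<noteq> [] \<Longrightarrow> \<forall>e\<in>set q. P e \<Longrightarrow> p = [] \<or> \<not> P (last p)
      \<Longrightarrow> r \<noteq> [] \<Longrightarrow> \<not> P (hd r) \<Longrightarrow> 0 \<le> sum_list (map f q)"
  shows "0 \<le> sum_list (map f L)"
  using assms
proof (induction "length L" arbitrary: L rule: less_induct)
  case less
  define q where "q = takeWhile P L"
  define r where "r = dropWhile P L"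
  have L: "L = q @ r" by (simp add: q_def r_def)
  have q: "\<forall>e\<in>set q. P e" by (auto simp: q_def dest: set_takeWhileD)
  show ?case
  proof (cases r)
    case Nil
    then have "L = []" using less.prems(1) L q by (cases "L = []") auto
    then show ?thesis by simp
  next
    case (Cons b s)
    have b: "\<not> P b" using Cons unfolding r_def by (simp add: dropWhile_eq_Cons_conv)
    have L': "L = (q @ [b]) @ s" using L Cons by simp
    have "0 \<le> sum_list (map f q)"
      using less.prems(3)[of "[]" q r] L q b Cons by (cases "q = []") auto
    moreover have "0 \<le> f b" using less.prems(2)[of b] L' b by auto
    moreover have "0 \<le> sum_list (map f s)"
    proof (rule less.hyps)
      show "length s < length L" using L' by simp
      show "\<not> P (last s)" if "s \<noteq> []" using less.prems(1) L' that by auto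
      show "0 \<le> f e" if "e \<in> set s" "\<not> P e" for e using less.prems(2) L' that by auto
      \<comment> \<open>A block at the very start of \<open>s\<close> is preceded in
        \<open>L\<close> by \<open>b\<close>, which is outside \<open>P\<close>, so blocks maximal
        in \<open>s\<close> stay maximal in \<open>L\<close>.\<close>
      show "0 \<le> sum_list (map f q')"
        if "s = p @ q' @ r'" "q' \<noteq> []" "\<forall>e\<in>set q'. P e" "p = [] \<or> \<not> P (last p)"
          "r' \<noteq> []" "\<not> P (hd r')" for p q' r'
        using that less.prems(3)[of "q @ b # p" q' r'] L' b by auto
    qed
    ultimately show ?thesis using L' by (simp add: add_nonneg_nonneg)
  qed
qed

lemma not_from_A [simp]: "\<not> from_A e \<longleftrightarrow> from_B e"
  by (cases "origin e") auto

text \<open>Rotating further by \<open>length p\<close> brings \<open>q\<close> to the front. The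
  remainder \<open>r @ p\<close> starts and ends with a B'-edge; if \<open>p\<close> is empty, its
  last edge is \<open>last r\<close>.\<close>

lemma max_A_path_block:
  assumes "rotate n C = p @ q @ r" and "q \<noteq> []" and "\<forall>e\<in>set q. from_A e"
    and "p = [] \<or> from_B (last p)" and "r \<noteq> []" and "from_B (hd r)" and "from_B (last r)"
  shows "q \<in> set (max_A_paths C)"
proof -
  have "rotate (length p + n) C = q @ (r @ p)"
    using assms(1) by (simp add: rotate_rotate[symmetric] rotate_append)
  moreover have "from_B (hd (r @ p))" "from_B (last (r @ p))" "r @ p \<noteq> []"
    using assms by (cases "p = []"; auto)+
  ultimately show ?thesis
    unfolding set_max_A_paths using assms(2,3) by blast
qed

lemma sum_list_max_A_paths_nonneg:
  fixes f :: "'v edge \<Rightarrow> rat"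
  assumes "e \<in> set C" and "from_B e"
    and B: "\<And>e. e \<in> set C \<Longrightarrow> from_B e \<Longrightarrow> 0 \<le> f e"
    and A: "\<And>q. q \<in> set (max_A_paths C) \<Longrightarrow> 0 \<le> sum_list (map f q)"
  shows "0 \<le> sum_list (map f C)"
proof -
  obtain xs ys where C: "C = xs @ e # ys"
    using assms(1) by (auto simp: in_set_conv_decomp)
  \<comment> \<open>Rotating just past \<open>e\<close> puts this B'-edge last, so that no maximal
    A'-path wraps around and the cycle can be cut as a list.\<close>
  define n where "n = Suc (length xs)"
  have D: "rotate n C = ys @ xs @ [e]"
    using rotate_append[of "xs @ [e]" ys] by (simp add: C n_def)
  have "0 \<le> sum_list (map f (rotate n C))"
  proof (rule sum_list_blocks_nonneg[where P = from_A])
    show "\<not> from_A (last (rotate n C))"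
      using assms(2) D by simp
    show "0 \<le> f e" if "e \<in> set (rotate n C)" "\<not> from_A e" for e
      using B that by simp
    show "0 \<le> sum_list (map f q)"
      if "rotate n C = p @ q @ r" "q \<noteq> []" "\<forall>e\<in>set q. from_A e" "p = [] \<or> \<not> from_A (last p)"
        "r \<noteq> []" "\<not> from_A (hd r)" for p q r
    proof (rule A, rule max_A_path_block)
      have "last r = e"
        using D that(1,5) by (metis append_is_Nil_conv last_appendR last_snoc)
      then show "from_B (last r)" using assms(2) by simp
    qed (use that in auto)
  qed
  then show ?thesis unfolding D by (simp add: C algebra_simps)
qed

theorem mainTheorem7:
  fixes A B :: "'x lin_atom set" and C :: "'x dvar edge list"
  assumes "finite A" and "finite B"
    and "\<forall>c\<in>A. is_utvpi c" and "\<forall>c\<in>B. is_utvpi c"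
    and "\<not> (\<exists>\<sigma>. sat_set \<sigma> A \<and> sat_set \<sigma> B)"
    and "negative_cycle (constraint_graph (encode_set A) (encode_set B)) C"
  shows "interpolant A B (Ups (dl_interpolant C))"
proof -
  define G where "G = constraint_graph (encode_set A) (encode_set B)"
  interpret wf_digraph G unfolding G_def by (rule wf_constraint_graph)
  have G_simps: "tail G = src" "head G = tgt"
    "arcs G = Edge FromA ` encode_set A \<union> Edge FromB ` encode_set B"
    by (auto simp: G_def constraint_graph_def)
  from assms(6) have closed: "closed_w C" and neg: "weight C < 0"
    by (auto simp: negative_cycle_def G_def)
  then obtain u where u: "awalk u C u" and ne: "C \<noteq> []"
    by (auto simp: closed_w_def)
  have arcs: "set C \<subseteq> arcs G" using u by auto
  have in_A: "constr e \<in> encode_set A" if "e \<in> set C" "from_A e" for e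
    using arcs that by (auto simp: G_simps)
  have in_B: "constr e \<in> encode_set B" if "e \<in> set C" "from_B e" for e
    using arcs that by (auto simp: G_simps)
  have slack_A: "0 \<le> slack \<sigma> e" if "e \<in> set C" "from_A e" "sat_set \<sigma> A" for \<sigma> e
    using encode_set_sound[OF in_A] that by (simp add: lin_holds_iff_slack)
  have slack_B: "0 \<le> slack \<sigma> e" if "e \<in> set C" "from_B e" "sat_set \<sigma> B" for \<sigma> e
    using encode_set_sound[OF in_B] that by (simp add: lin_holds_iff_slack)
  have "cas u C u" using u by auto
  \<comment> \<open>Start and end potentials of the cycle agree, so its slack sum is its negative
    weight under every assignment.\<close>
  then have sum_neg: "sum_list (map (slack \<sigma>) C) < 0" for \<sigma>
    using sum_slack_cas[of "encode_set A" "encode_set B" u C u \<sigma>] neg by (simp add: G_def)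
  have path: "set q \<subseteq> set C"
    "lin_holds \<sigma> (Ups_constr (summary q)) \<longleftrightarrow> 0 \<le> sum_list (map (slack \<sigma>) q)"
    "lin_vars (Ups_constr (summary q)) \<subseteq> vars_set A \<inter> vars_set B"
    if "q \<in> set (max_A_paths C)" for q \<sigma>
  proof -
    from that obtain n r where q: "q \<noteq> []" "\<forall>e\<in>set q. from_A e"
      and r: "rotate n C = q @ r" "r \<noteq> []" "from_B (hd r)" "from_B (last r)"
      unfolding set_max_A_paths by blast
    have sub: "set q \<subseteq> set C" "set r \<subseteq> set C"
      using set_rotate[of n C] unfolding r(1) by auto
    show "set q \<subseteq> set C" by fact
    have "closed_w (q @ r)"
      using closed_w_rotate[OF closed, of n] r(1) by simp
    then obtain w where "awalk w (q @ r) w" by (auto simp: closed_w_def)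
    then obtain v where cas: "cas w q v" "cas v r w" by auto
    \<comment> \<open>The rest \<open>r\<close> of the cycle leads from \<open>v\<close> back to
      \<open>w\<close>. Each end point of \<open>q\<close> thus lies on an A'-edge of
      \<open>q\<close> and on the first or last edge of \<open>r\<close>, a B'-edge.\<close>
    have w: "w = src (hd q)" "w = tgt (last r)" and v: "v = tgt (last q)" "v = src (hd r)"
      using cas_endpoints[OF cas(1)] cas_endpoints[OF cas(2)] q(1) r(2) by (auto simp: G_simps)
    show "lin_holds \<sigma> (Ups_constr (summary q)) \<longleftrightarrow> 0 \<le> sum_list (map (slack \<sigma>) q)"
      using sum_slack_cas[of "encode_set A" "encode_set B" w q v \<sigma>] cas(1) w(1) v(1)
      by (auto simp: G_def summary_def)
    have A: "var (Ups_var (src e)) \<in> vars_set A" "var (Ups_var (tgt e)) \<in> vars_set A"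
      if "e \<in> set q" for e
      using encode_set_vars[OF in_A, of e] sub q that
      by (auto simp: lin_vars_Ups_constr src_def tgt_def)
    have B: "var (Ups_var (src e)) \<in> vars_set B" "var (Ups_var (tgt e)) \<in> vars_set B"
      if "e \<in> set r" "from_B e" for e
      using encode_set_vars[OF in_B, of e] sub that
      by (auto simp: lin_vars_Ups_constr src_def tgt_def)
    have "var (Ups_var w) \<in> vars_set A \<inter> vars_set B"
      using A(1)[of "hd q"] B(2)[of "last r"] q(1) r w by simp
    moreover have "var (Ups_var v) \<in> vars_set A \<inter> vars_set B"
      using A(2)[of "last q"] B(1)[of "hd r"] q(1) r v by simp
    ultimately show "lin_vars (Ups_constr (summary q)) \<subseteq> vars_set A \<inter> vars_set B"
      using w(1) v(1) by (simp add: lin_vars_Ups_constr summary_def)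
  qed
  consider (allA) "\<forall>e\<in>set C. from_A e"
    | (allB) "\<not> (\<forall>e\<in>set C. from_A e)" "\<forall>e\<in>set C. from_B e"
    | (mixed) "\<not> (\<forall>e\<in>set C. from_A e)" "\<not> (\<forall>e\<in>set C. from_B e)"
    by blast
  then show ?thesis
  proof cases
    case allA
    \<comment> \<open>A model of \<open>A\<close> would make every slack on the cycle nonnegative.
      So \<open>A\<close> alone is unsatisfiable and entails \<open>Bot\<close>.\<close>
    have "\<not> sat_set \<sigma> A" for \<sigma>
      using sum_neg[of \<sigma>] sum_list_nonneg[of "map (slack \<sigma>) C"] slack_A allA by fastforce
    then show ?thesis
      using allA by (simp add: interpolant_def dl_interpolant_def Ups_def vars_set_def)
  next
    case allB
    have "\<not> sat_set \<sigma> B" for \<sigma>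
      using sum_neg[of \<sigma>] sum_list_nonneg[of "map (slack \<sigma>) C"] slack_B allB by fastforce
    then show ?thesis
      using allB by (auto simp: interpolant_def dl_interpolant_def Ups_def vars_set_def)
  next
    case mixed
    have I: "dl_interpolant C = conj_list (map (\<lambda>p. Atom (summary p)) (max_A_paths C))"
      unfolding dl_interpolant_def using mixed by (simp only: if_False)
    have eval: "eval_formula (lin_holds \<sigma>) (Ups (dl_interpolant C)) \<longleftrightarrow>
        (\<forall>q\<in>set (max_A_paths C). 0 \<le> sum_list (map (slack \<sigma>) q))" for \<sigma>
      using path(2) by (auto simp: I Ups_def eval_map_formula eval_conj_list)
    have "eval_formula (lin_holds \<sigma>) (Ups (dl_interpolant C))" if "sat_set \<sigma> A" for \<sigma>
      unfolding eval
    proof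
      fix q assume q: "q \<in> set (max_A_paths C)"
      then have "from_A e" if "e \<in> set q" for e
        using that unfolding set_max_A_paths by blast
      then show "0 \<le> sum_list (map (slack \<sigma>) q)"
        using path(1)[OF q] slack_A \<open>sat_set \<sigma> A\<close> by (intro sum_list_nonneg) auto
    qed
    moreover have "\<not> sat_set \<sigma> B"
      if "eval_formula (lin_holds \<sigma>) (Ups (dl_interpolant C))" for \<sigma>
    proof
      assume sat: "sat_set \<sigma> B"
      \<comment> \<open>The cycle can be cut at a B'-edge. The B'-edges have nonnegative slack by
        \<open>sat\<close>, and the A'-paths have nonnegative slack sum by the interpolant.\<close>
      obtain e where "e \<in> set C" "from_B e" using mixed(1) by auto
      then have "0 \<le> sum_list (map (slack \<sigma>) C)"
        by (rule sum_list_max_A_paths_nonneg) (use slack_B sat that eval in auto)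
      then show False using sum_neg[of \<sigma>] by simp
    qed
    moreover have "vars_set (atoms (Ups (dl_interpolant C))) \<subseteq> vars_set A \<inter> vars_set B"
      using path(3) by (auto simp: I Ups_def formula.set_map atoms_conj_list vars_set_def[of "_ ` _"])
    ultimately show ?thesis unfolding interpolant_def by blast
  qed
qed

end
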